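(* Let $a<b$ in $\mathbb{R}$, $0\le\alpha\le1$ and $\beta\in\mathbb{R}$. There exists a positive constant $K$ such that for any (real-valued) $f\in L^1[a,b]$, $$\|\mathcal{I}_{a+}^{(\alpha,\beta)}f\|_1\le K\|f\|_1,$$ and, if we also assume $f$ is continuous, $$\|\mathcal{I}_{a+}^{(\alpha,\beta)}f\|_\infty\le K\|f\|_\infty.$$ Here $\|\cdot\|_1$ and $\|\cdot\|_\infty$ are the $L^1$ and $L^\infty$ norms on $[a,b]$.
   Context: $B$ is a fixed multiplier function of $\alpha$, taking real positive values, with $B(0)=B(1)=1$. For $\nu>0$ the Riemann--Liouville fractional integral is ${}^{RL}I_{a+}^{\nu}f(t)=\frac{1}{\Gamma(\nu)}\int_a^t(t-x)^{\nu-1}f(x)\,\mathrm{d}x$, and ${}^{RL}I_{a+}^{0}f=f$. For real $\beta$ and integer $k\ge0$, $\binom{\beta}{k}=\frac{\beta(\beta-1)\cdots(\beta-k+1)}{k!}$, with $\binom{\beta}{0}=1$. For $0\le\alpha\le1$, $\beta\in\mathbb{R}$ (of any sign), $a<b$ in $\mathbb{R}$ and an $L^1$ function $f:[a,b]\to\mathbb{R}$, the iterated AB differintegral of $f$ is defined by $$\mathcal{I}_{a+}^{(\alpha,\beta)}f(t)=\sum_{k=0}^{\infty}\frac{\binom{\beta}{k}(1-\alpha)^{\beta-k}\alpha^k}{B(\alpha)^{\beta}}\,{}^{RL}I_{a+}^{\alpha k}f(t)$$ (with $0^0=1$). Convergence of this series is regarded as given by the boundedness statement. *)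

theory Defs
  imports "HOL-Analysis.Analysis" "HOL-Probability.Essential_Supremum"
begin

text \<open>
  Real power with \<open>0\<^sup>0 = 1\<close> (the library has \<open>0 powr 0 = 0\<close>). As with \<open>powr\<close>, a negative power
  of \<open>0\<close> is \<open>0\<close> by convention.
\<close>
definition rpow :: "real \<Rightarrow> real \<Rightarrow> real" where
  "rpow x y = (if y = 0 then 1 else x powr y)"

definition RL_integral :: "real \<Rightarrow> real \<Rightarrow> (real \<Rightarrow> real) \<Rightarrow> real \<Rightarrow> real" where
  "RL_integral a \<nu> f t =
     (if \<nu> = 0 then f t
      else 1 / Gamma \<nu> * (LINT x|lebesgue_on {a..t}. (t - x) powr (\<nu> - 1) * f x))"

definition RL_integral_exists :: "real \<Rightarrow> real \<Rightarrow> (real \<Rightarrow> real) \<Rightarrow> real \<Rightarrow> bool" where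
  "RL_integral_exists a \<nu> f t \<longleftrightarrow>
     \<nu> = 0 \<or> integrable (lebesgue_on {a..t}) (\<lambda>x. (t - x) powr (\<nu> - 1) * f x)"

text \<open>
  For \<open>\<alpha> = 1\<close> and \<open>\<beta> = n\<close> a natural number, only the term \<open>k = n\<close> survives (for \<open>k > n\<close> the
  binomial coefficient vanishes). For \<open>\<alpha> = 1\<close> and other \<open>\<beta>\<close> the series has negative powers of
  \<open>0\<close>, which are \<open>0\<close> by the convention above.
\<close>
definition AB_term ::
  "(real \<Rightarrow> real) \<Rightarrow> real \<Rightarrow> real \<Rightarrow> real \<Rightarrow> (real \<Rightarrow> real) \<Rightarrow> real \<Rightarrow> nat \<Rightarrow> real" where
  "AB_term B a \<alpha> \<beta> f t k =
     (\<beta> gchoose k) * rpow (1 - \<alpha>) (\<beta> - real k) * \<alpha> ^ k / B \<alpha> powr \<beta>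
       * RL_integral a (\<alpha> * real k) f t"

definition iterated_AB ::
  "(real \<Rightarrow> real) \<Rightarrow> real \<Rightarrow> real \<Rightarrow> real \<Rightarrow> (real \<Rightarrow> real) \<Rightarrow> real \<Rightarrow> real" where
  "iterated_AB B a \<alpha> \<beta> f t = (\<Sum>k. AB_term B a \<alpha> \<beta> f t k)"

text \<open>
  All integrals in the series exist and the series converges at \<open>t\<close>, so that
  \<open>iterated_AB B a \<alpha> \<beta> f t\<close> is not a default value of \<open>suminf\<close> or of the Lebesgue integral.
\<close>
definition iterated_AB_exists ::
  "(real \<Rightarrow> real) \<Rightarrow> real \<Rightarrow> real \<Rightarrow> real \<Rightarrow> (real \<Rightarrow> real) \<Rightarrow> real \<Rightarrow> bool" where
  "iterated_AB_exists B a \<alpha> \<beta> f t \<longleftrightarrow>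
     (\<forall>k. RL_integral_exists a (\<alpha> * real k) f t) \<and> summable (AB_term B a \<alpha> \<beta> f t)"

text \<open>The library integral of a non-integrable function is \<open>0\<close>: only meaningful with integrability.\<close>
definition L1_norm :: "real \<Rightarrow> real \<Rightarrow> (real \<Rightarrow> real) \<Rightarrow> real" where
  "L1_norm a b f = (LINT t|lebesgue_on {a..b}. \<bar>f t\<bar>)"

definition Linf_norm :: "real \<Rightarrow> real \<Rightarrow> (real \<Rightarrow> real) \<Rightarrow> ereal" where
  "Linf_norm a b f = esssup (lebesgue_on {a..b}) (\<lambda>t. ereal \<bar>f t\<bar>)"

end

theory Submission
  imports Defs
begin

text \<open>
  The kernel \<open>(t - x) powr (\<nu> - 1) / Gamma \<nu>\<close> of the Riemann--Liouville integral has mass at most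
  \<open>(b - a) powr \<nu> / Gamma (\<nu> + 1)\<close> on \<open>{a..b}\<close> in either variable. Hence, by Tonelli in the \<open>L\<^sup>1\<close>
  case, this number bounds the operator norm both on \<open>L\<^sup>1\<close> and on \<open>L\<^sup>\<infinity>\<close>. Weighted with the
  coefficients of the AB series these norms are summable: the coefficients grow at most geometrically
  when \<open>0 < \<alpha> < 1\<close> (and vanish for almost all \<open>k\<close> otherwise), while \<open>Gamma (\<alpha> * k + 1)\<close> grows
  faster than any geometric sequence.
\<close>

section \<open>Growth of Gamma and summability of the weighted coefficients\<close>

lemma Gamma_lower_bound:
  fixes L x :: real
  assumes "L > 0" "x \<ge> 0"
  shows "L powr x / exp (L + 1) \<le> Gamma (x + 1)"
proof -
  \<comment> \<open>Keep only \<open>[L, L + 1]\<close> in Euler's integral.\<close>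
  have "((\<lambda>t. L powr x / exp (L + 1)) has_integral (L powr x / exp (L + 1)) * (L + 1 - L)) {L..L + 1}"
    using has_integral_const_real[of "L powr x / exp (L + 1)" L "L + 1"] by simp
  moreover have "((\<lambda>t. t powr x / exp t) has_integral Gamma (x + 1)) {0..}"
    using Gamma_integral_real[of "x + 1"] assms by simp
  then have "((\<lambda>t. if t \<in> {0..} then t powr x / exp t else 0) has_integral Gamma (x + 1)) UNIV"
    by (subst has_integral_restrict_UNIV)
  moreover have "((\<lambda>t. if t \<in> {L..L + 1} then L powr x / exp (L + 1) else 0)
      has_integral (L powr x / exp (L + 1)) * (L + 1 - L)) UNIV"
    using calculation(1) by (subst has_integral_restrict_UNIV)
  ultimately have "(L powr x / exp (L + 1)) * (L + 1 - L) \<le> Gamma (x + 1)"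
    using assms by (elim has_integral_le) (auto intro!: frac_le powr_mono2)
  then show ?thesis by simp
qed

lemma summable_Mittag_Leffler:
  fixes \<alpha> q :: real
  assumes "\<alpha> > 0" "q \<ge> 0"
  shows "summable (\<lambda>k. q ^ k / Gamma (\<alpha> * real k + 1))"
proof -
  \<comment> \<open>This \<open>L\<close> makes the lower bound for \<open>Gamma (\<alpha> * k + 1)\<close> geometric with a ratio larger than \<open>q\<close>.\<close>
  define L where "L = (2 * q + 1) powr (1 / \<alpha>)"
  have L: "L > 0" using assms by (simp add: L_def)
  have Lk: "L powr (\<alpha> * real k) = (2 * q + 1) ^ k" for k
    using assms by (simp add: L_def powr_powr powr_realpow)
  have "summable (\<lambda>k. exp (L + 1) * (q / (2 * q + 1)) ^ k)"
    using assms by (intro summable_mult summable_geometric) auto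
  then show ?thesis
  proof (rule summable_comparison_test'[where N = 0])
    fix k :: nat
    have "(2 * q + 1) ^ k / exp (L + 1) \<le> Gamma (\<alpha> * real k + 1)"
      using Gamma_lower_bound[OF L, of "\<alpha> * real k"] assms by (simp add: Lk)
    moreover have "Gamma (\<alpha> * real k + 1) > 0"
      using assms by (intro Gamma_real_pos) (simp add: add_nonneg_pos)
    ultimately have "q ^ k / Gamma (\<alpha> * real k + 1) \<le> q ^ k / ((2 * q + 1) ^ k / exp (L + 1))"
      using assms by (intro divide_left_mono mult_pos_pos) auto
    also have "\<dots> = exp (L + 1) * (q / (2 * q + 1)) ^ k"
      by (simp add: power_divide)
    finally show "norm (q ^ k / Gamma (\<alpha> * real k + 1)) \<le> exp (L + 1) * (q / (2 * q + 1)) ^ k"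
      using assms \<open>Gamma (\<alpha> * real k + 1) > 0\<close> by simp
  qed
qed

text \<open>Consecutive coefficients have the quotient \<open>(\<beta> - k) / (k + 1)\<close>, of
  modulus at most \<open>\<bar>\<beta>\<bar> + 1\<close>. Such crude geometric growth is still
  beaten by Gamma.\<close>

lemma abs_gbinomial_le:
  fixes \<beta> :: real
  shows "\<bar>\<beta> gchoose k\<bar> \<le> (\<bar>\<beta>\<bar> + 1) ^ k"
proof (induction k)
  case (Suc k)
  have "real (Suc k) * (\<beta> gchoose Suc k) = (\<beta> - real k) * (\<beta> gchoose k)"
    using gbinomial_mult_1[of \<beta> k] by (simp add: algebra_simps)
  then have "(\<beta> gchoose Suc k) = (\<beta> - real k) / real (Suc k) * (\<beta> gchoose k)"
    by (simp add: field_simps)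
  moreover have "\<bar>(\<beta> - real k) / real (Suc k)\<bar> \<le> \<bar>\<beta>\<bar> + 1"
  proof -
    have "\<bar>\<beta> - real k\<bar> \<le> \<bar>\<beta>\<bar> * 1 + real (Suc k)" by simp
    also have "\<dots> \<le> \<bar>\<beta>\<bar> * real (Suc k) + real (Suc k)"
      by (intro add_right_mono mult_left_mono) auto
    finally show ?thesis by (simp add: pos_divide_le_eq algebra_simps)
  qed
  ultimately show ?case
    unfolding power_Suc abs_mult using Suc.IH by (simp only: abs_mult) (intro mult_mono, auto)
qed simp

definition AB_coeff :: "(real \<Rightarrow> real) \<Rightarrow> real \<Rightarrow> real \<Rightarrow> nat \<Rightarrow> real" where
  "AB_coeff B \<alpha> \<beta> k = (\<beta> gchoose k) * rpow (1 - \<alpha>) (\<beta> - real k) * \<alpha> ^ k / B \<alpha> powr \<beta>"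

lemma AB_term_eq: "AB_term B a \<alpha> \<beta> f t k = AB_coeff B \<alpha> \<beta> k * RL_integral a (\<alpha> * real k) f t"
  by (simp add: AB_term_def AB_coeff_def)

lemma summable_AB_coeff:
  fixes T :: real
  assumes "0 \<le> \<alpha>" "\<alpha> \<le> 1" "T > 0"
  shows "summable (\<lambda>k. \<bar>AB_coeff B \<alpha> \<beta> k\<bar> * (T powr (\<alpha> * real k) / Gamma (\<alpha> * real k + 1)))"
proof -
  consider "\<alpha> = 0" | "\<alpha> = 1" | "0 < \<alpha>" "\<alpha> < 1" using assms by linarith
  then show ?thesis
  proof cases
    case 1
    \<comment> \<open>Here \<open>\<alpha> ^ k\<close> vanishes except at
      \<open>k = 0\<close>.\<close>
    then show ?thesis
      by (intro summable_finite[of "{0}"]) (auto simp: AB_coeff_def)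
  next
    case 2
    \<comment> \<open>The base \<open>1 - \<alpha>\<close> is 0, and \<open>rpow\<close> then gives
      1 at exponent 0 and 0 at any other, so at most the single index \<open>k = \<beta>\<close>
      survives.\<close>
    have "{k. real k = \<beta>} \<subseteq> {nat \<lfloor>\<beta>\<rfloor>}" by auto
    then have "finite {k. real k = \<beta>}" using finite_subset by blast
    with 2 show ?thesis
      by (intro summable_finite[of "{k. real k = \<beta>}"]) (auto simp: AB_coeff_def rpow_def)
  next
    case 3
    \<comment> \<open>\<open>q\<close> gathers everything raised to the power \<open>k\<close>: the
      binomial bound, the quotient of \<open>\<alpha> ^ k\<close> by
      \<open>(1 - \<alpha>) ^ k\<close>, and \<open>T powr (\<alpha> * k)\<close>. \<open>D\<close>
      collects the factors independent of \<open>k\<close>.\<close>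
    define q where "q = (\<bar>\<beta>\<bar> + 1) * (\<alpha> / (1 - \<alpha>)) * T powr \<alpha>"
    define D where "D = (1 - \<alpha>) powr \<beta> / \<bar>B \<alpha> powr \<beta>\<bar>"
    have "summable (\<lambda>k. D * (q ^ k / Gamma (\<alpha> * real k + 1)))"
      using 3 by (intro summable_mult summable_Mittag_Leffler) (auto simp: q_def)
    then show ?thesis
    proof (rule summable_comparison_test'[where N = 0])
      fix k :: nat
      have G: "Gamma (\<alpha> * real k + 1) > 0"
        using 3 by (intro Gamma_real_pos) (simp add: add_nonneg_pos)
      have "rpow (1 - \<alpha>) (\<beta> - real k) = (1 - \<alpha>) powr \<beta> / (1 - \<alpha>) ^ k"
        using 3 by (auto simp: rpow_def powr_diff powr_realpow)
      then have "\<bar>AB_coeff B \<alpha> \<beta> k\<bar> = \<bar>\<beta> gchoose k\<bar> * (D * (\<alpha> / (1 - \<alpha>)) ^ k)"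
        using 3 by (simp add: AB_coeff_def D_def abs_mult power_divide mult_ac)
      also have "\<dots> \<le> (\<bar>\<beta>\<bar> + 1) ^ k * (D * (\<alpha> / (1 - \<alpha>)) ^ k)"
        using 3 by (intro mult_right_mono abs_gbinomial_le) (auto simp: D_def)
      finally have "\<bar>AB_coeff B \<alpha> \<beta> k\<bar> * (T powr (\<alpha> * real k) / Gamma (\<alpha> * real k + 1)) \<le>
          (\<bar>\<beta>\<bar> + 1) ^ k * (D * (\<alpha> / (1 - \<alpha>)) ^ k) * (T powr (\<alpha> * real k) / Gamma (\<alpha> * real k + 1))"
        using G by (intro mult_right_mono) auto
      moreover have "T powr (\<alpha> * real k) = (T powr \<alpha>) ^ k"
        using assms by (simp add: powr_powr[symmetric] powr_realpow)
      ultimately show "norm (\<bar>AB_coeff B \<alpha> \<beta> k\<bar> * (T powr (\<alpha> * real k) / Gamma (\<alpha> * real k + 1)))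
          \<le> D * (q ^ k / Gamma (\<alpha> * real k + 1))"
        using G assms by (simp add: q_def power_mult_distrib power_divide abs_mult mult_ac)
    qed
  qed
qed

section \<open>The Riemann-Liouville kernel and its mass\<close>

text \<open>Extension by zero to \<open>x > t\<close> replaces the varying domain
  \<open>{a..t}\<close> by the fixed \<open>{a..b}\<close>, so that Tonelli applies on a
  square.\<close>

definition RL_kernel :: "real \<Rightarrow> real \<Rightarrow> real \<Rightarrow> real" where
  "RL_kernel \<nu> t x = (if x \<le> t then (t - x) powr (\<nu> - 1) / Gamma \<nu> else 0)"

text \<open>Being an \<open>ennreal\<close> integral of absolute values, it makes sense at every
  \<open>t\<close>, and its finiteness encodes existence of the Riemann-Liouville integral. Order 0
  is the identity operator and has no kernel function.\<close>

definition RL_majorant :: "real \<Rightarrow> real \<Rightarrow> real \<Rightarrow> (real \<Rightarrow> real) \<Rightarrow> real \<Rightarrow> ennreal" where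
  "RL_majorant a b \<nu> f t =
     (if \<nu> = 0 then ennreal \<bar>f t\<bar>
      else \<integral>\<^sup>+x. ennreal (RL_kernel \<nu> t x) * ennreal \<bar>f x\<bar> \<partial>lebesgue_on {a..b})"

lemma sigma_finite_lebesgue_on_ivl: "sigma_finite_measure (lebesgue_on {a..b::real})"
proof -
  interpret finite_measure "lebesgue_on {a..b}"
    by (rule finite_measure_lebesgue_on) simp
  show ?thesis by unfold_locales
qed

lemma RL_kernel_nonneg: "\<nu> > 0 \<Longrightarrow> RL_kernel \<nu> t x \<ge> 0"
  by (auto simp: RL_kernel_def intro!: divide_nonneg_pos)

lemma measurable_id_lebesgue_on [measurable]: "(\<lambda>x. x) \<in> borel_measurable (lebesgue_on S)"
  for S :: "real set"
  by (rule measurable_restrict_space1) (simp add: measurable_completion)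

lemma measurable_RL_kernel [measurable]:
  assumes [measurable]: "f \<in> borel_measurable M" "g \<in> borel_measurable M"
  shows "(\<lambda>x. RL_kernel \<nu> (f x) (g x)) \<in> borel_measurable M"
  unfolding RL_kernel_def by measurable

text \<open>Integrating the power gives \<open>T powr \<nu> / \<nu>\<close>, and
  \<open>\<nu> * Gamma \<nu> = Gamma (\<nu> + 1)\<close>.\<close>

lemma nn_integral_RL_power:
  assumes "\<nu> > 0" "T \<ge> 0"
  shows "(\<integral>\<^sup>+u. ennreal (u powr (\<nu> - 1) / Gamma \<nu>) * indicator {0..T} u \<partial>lborel)
    = ennreal (T powr \<nu> / Gamma (\<nu> + 1))"
proof -
  have "((\<lambda>u. u powr (\<nu> - 1) / Gamma \<nu>) has_integral (T powr \<nu> / \<nu>) / Gamma \<nu>) {0..T}"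
    using has_integral_powr_from_0[of "\<nu> - 1" T] assms by (intro has_integral_divide) simp
  then have "((\<lambda>u. u powr (\<nu> - 1) / Gamma \<nu>) has_integral T powr \<nu> / Gamma (\<nu> + 1)) {0..T}"
    using assms by (subst Gamma_plus1) (auto simp: nonpos_Ints_def)
  then show ?thesis
    by (intro nn_integral_has_integral_lebesgue') (use assms in auto)
qed

text \<open>The reflection \<open>u = t - x\<close> turns the kernel into a pure power of
  \<open>u\<close>. It vanishes for \<open>u < 0\<close>, and
  \<open>u \<le> t - a \<le> b - a\<close>.\<close>

lemma nn_integral_RL_kernel_right:
  assumes "\<nu> > 0" "t \<in> {a..b}"
  shows "(\<integral>\<^sup>+x. ennreal (RL_kernel \<nu> t x) \<partial>lebesgue_on {a..b}) \<le> ennreal ((b - a) powr \<nu> / Gamma (\<nu> + 1))"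
proof -
  have "(\<integral>\<^sup>+x. ennreal (RL_kernel \<nu> t x) \<partial>lebesgue_on {a..b})
    = (\<integral>\<^sup>+x. ennreal (RL_kernel \<nu> t x) * indicator {a..b} x \<partial>lborel)"
    by (simp add: nn_integral_restrict_space nn_integral_completion)
  also have "\<dots> = (\<integral>\<^sup>+u. ennreal (RL_kernel \<nu> t (t - u)) * indicator {a..b} (t - u) \<partial>lborel)"
    by (subst nn_integral_real_affine[where c = "-1" and t = t]) auto
  also have "\<dots> \<le> (\<integral>\<^sup>+u. ennreal (u powr (\<nu> - 1) / Gamma \<nu>) * indicator {0..b - a} u \<partial>lborel)"
    using assms by (intro nn_integral_mono) (auto simp: RL_kernel_def indicator_def)
  also have "\<dots> = ennreal ((b - a) powr \<nu> / Gamma (\<nu> + 1))"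
    using assms by (intro nn_integral_RL_power) auto
  finally show ?thesis .
qed

text \<open>As for the other variable, with the translation \<open>u = t - x\<close> for fixed
  \<open>x\<close> and \<open>u \<le> b - x \<le> b - a\<close>.\<close>

lemma nn_integral_RL_kernel_left:
  assumes "\<nu> > 0" "x \<in> {a..b}"
  shows "(\<integral>\<^sup>+t. ennreal (RL_kernel \<nu> t x) \<partial>lebesgue_on {a..b}) \<le> ennreal ((b - a) powr \<nu> / Gamma (\<nu> + 1))"
proof -
  have "(\<integral>\<^sup>+t. ennreal (RL_kernel \<nu> t x) \<partial>lebesgue_on {a..b})
    = (\<integral>\<^sup>+t. ennreal (RL_kernel \<nu> t x) * indicator {a..b} t \<partial>lborel)"
    by (simp add: nn_integral_restrict_space nn_integral_completion)
  also have "\<dots> = (\<integral>\<^sup>+u. ennreal (RL_kernel \<nu> (x + u) x) * indicator {a..b} (x + u) \<partial>lborel)"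
    by (subst nn_integral_real_affine[where c = 1 and t = x]) auto
  also have "\<dots> \<le> (\<integral>\<^sup>+u. ennreal (u powr (\<nu> - 1) / Gamma \<nu>) * indicator {0..b - a} u \<partial>lborel)"
    using assms by (intro nn_integral_mono) (auto simp: RL_kernel_def indicator_def)
  also have "\<dots> = ennreal ((b - a) powr \<nu> / Gamma (\<nu> + 1))"
    using assms by (intro nn_integral_RL_power) auto
  finally show ?thesis .
qed

section \<open>Norm bounds for the majorant of a single Riemann-Liouville integral\<close>

lemma measurable_RL_majorant:
  assumes [measurable]: "f \<in> borel_measurable (lebesgue_on {a..b})"
  shows "RL_majorant a b \<nu> f \<in> borel_measurable (lebesgue_on {a..b})"
proof -
  interpret sigma_finite_measure "lebesgue_on {a..b}"
    by (rule sigma_finite_lebesgue_on_ivl)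
  show ?thesis
    unfolding RL_majorant_def by (cases "\<nu> = 0") simp_all
qed

lemma nn_integral_RL_majorant_le:
  assumes [measurable]: "f \<in> borel_measurable (lebesgue_on {a..b})" and "\<nu> \<ge> 0" "a < b"
  shows "(\<integral>\<^sup>+t. RL_majorant a b \<nu> f t \<partial>lebesgue_on {a..b})
    \<le> ennreal ((b - a) powr \<nu> / Gamma (\<nu> + 1)) * (\<integral>\<^sup>+x. ennreal \<bar>f x\<bar> \<partial>lebesgue_on {a..b})"
proof (cases "\<nu> = 0")
  case True
  \<comment> \<open>The factor is 1 at order 0; \<open>a < b\<close> excludes the default value
    \<open>0 powr 0 = 0\<close>.\<close>
  with \<open>a < b\<close> show ?thesis by (simp add: RL_majorant_def)
next
  case False
  with assms have \<nu>: "\<nu> > 0" by simp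
  let ?M = "lebesgue_on {a..b}"
  interpret pair_sigma_finite ?M ?M
    by (intro pair_sigma_finite.intro sigma_finite_lebesgue_on_ivl)
  have "(\<integral>\<^sup>+t. RL_majorant a b \<nu> f t \<partial>?M)
    = (\<integral>\<^sup>+t. \<integral>\<^sup>+x. ennreal (RL_kernel \<nu> t x) * ennreal \<bar>f x\<bar> \<partial>?M \<partial>?M)"
    using False by (simp add: RL_majorant_def)
  \<comment> \<open>After the exchange the inner integral runs over \<open>t\<close> and sees only
    the kernel, whose mass in that variable is already bounded.\<close>
  also have "\<dots> = (\<integral>\<^sup>+x. \<integral>\<^sup>+t. ennreal (RL_kernel \<nu> t x) * ennreal \<bar>f x\<bar> \<partial>?M \<partial>?M)"
    by (rule Fubini'[symmetric]) simp
  also have "\<dots> = (\<integral>\<^sup>+x. (\<integral>\<^sup>+t. ennreal (RL_kernel \<nu> t x) \<partial>?M) * ennreal \<bar>f x\<bar> \<partial>?M)"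
    by (simp add: nn_integral_multc)
  also have "\<dots> \<le> (\<integral>\<^sup>+x. ennreal ((b - a) powr \<nu> / Gamma (\<nu> + 1)) * ennreal \<bar>f x\<bar> \<partial>?M)"
    by (intro nn_integral_mono mult_right_mono nn_integral_RL_kernel_left \<nu>) auto
  also have "\<dots> = ennreal ((b - a) powr \<nu> / Gamma (\<nu> + 1)) * (\<integral>\<^sup>+x. ennreal \<bar>f x\<bar> \<partial>?M)"
    by (simp add: nn_integral_cmult)
  finally show ?thesis .
qed

text \<open>The bound at the point \<open>t\<close> itself serves order 0, where the majorant is
  \<open>\<bar>f t\<bar>\<close>; for positive order the almost-everywhere bound enters under the
  integral.\<close>

lemma RL_majorant_le_bound:
  assumes "\<nu> \<ge> 0" "a < b" "t \<in> {a..b}" "\<bar>f t\<bar> \<le> e" "AE x in lebesgue_on {a..b}. \<bar>f x\<bar> \<le> e"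
  shows "RL_majorant a b \<nu> f t \<le> ennreal ((b - a) powr \<nu> / Gamma (\<nu> + 1)) * ennreal e"
proof (cases "\<nu> = 0")
  case True
  with assms show ?thesis by (simp add: RL_majorant_def ennreal_leI)
next
  case False
  with assms have \<nu>: "\<nu> > 0" by simp
  let ?M = "lebesgue_on {a..b}"
  have "RL_majorant a b \<nu> f t \<le> (\<integral>\<^sup>+x. ennreal (RL_kernel \<nu> t x) * ennreal e \<partial>?M)"
    unfolding RL_majorant_def using False assms(5)
    by (auto intro!: nn_integral_mono_AE mult_left_mono ennreal_leI elim!: eventually_mono)
  also have "\<dots> = (\<integral>\<^sup>+x. ennreal (RL_kernel \<nu> t x) \<partial>?M) * ennreal e"
    by (simp add: nn_integral_multc)
  also have "\<dots> \<le> ennreal ((b - a) powr \<nu> / Gamma (\<nu> + 1)) * ennreal e"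
    by (intro mult_right_mono nn_integral_RL_kernel_right \<nu> assms) auto
  finally show ?thesis .
qed

section \<open>Riemann-Liouville integrals as kernel integrals over a fixed interval\<close>

lemma lebesgue_on_initial_ivl:
  assumes "t \<in> {a..b::real}"
  shows "lebesgue_on {a..t} = restrict_space (lebesgue_on {a..b}) {..t}"
proof -
  have "{a..b} \<inter> {..t} = {a..t}" using assms by auto
  then show ?thesis by (subst restrict_restrict_space) auto
qed

lemma RL_integral_eq:
  assumes "\<nu> > 0" "t \<in> {a..b}"
  shows "RL_integral a \<nu> f t = (LINT x|lebesgue_on {a..b}. RL_kernel \<nu> t x * f x)"
proof -
  have "RL_integral a \<nu> f t = 1 / Gamma \<nu> *
      (LINT x|lebesgue_on {a..b}. indicator {..t} x *\<^sub>R ((t - x) powr (\<nu> - 1) * f x))"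
    using assms unfolding RL_integral_def lebesgue_on_initial_ivl[OF assms(2)]
    by (subst integral_restrict_space) (auto simp: sets_restrict_space_iff)
  also have "\<dots> = (LINT x|lebesgue_on {a..b}. RL_kernel \<nu> t x * f x)"
    by (subst integral_mult_right_zero[symmetric], intro Bochner_Integration.integral_cong)
       (auto simp: RL_kernel_def indicator_def)
  finally show ?thesis .
qed

lemma RL_integral_exists_iff:
  assumes "\<nu> > 0" "t \<in> {a..b}"
  shows "RL_integral_exists a \<nu> f t \<longleftrightarrow> integrable (lebesgue_on {a..b}) (\<lambda>x. RL_kernel \<nu> t x * f x)"
proof -
  have G: "Gamma \<nu> \<noteq> 0" using Gamma_real_pos[OF assms(1)] by simp
  have "RL_integral_exists a \<nu> f t \<longleftrightarrow>
      integrable (lebesgue_on {a..b}) (\<lambda>x. indicator {..t} x *\<^sub>R ((t - x) powr (\<nu> - 1) * f x))"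
    using assms unfolding RL_integral_exists_def lebesgue_on_initial_ivl[OF assms(2)]
    by (subst integrable_restrict_space) (auto simp: sets_restrict_space_iff)
  \<comment> \<open>The kernel contains \<open>1 / Gamma \<nu>\<close> while the existence predicate
    does not; a nonzero constant factor leaves integrability unchanged.\<close>
  also have "(\<lambda>x. indicator {..t} x *\<^sub>R ((t - x) powr (\<nu> - 1) * f x)) = (\<lambda>x. Gamma \<nu> * (RL_kernel \<nu> t x * f x))"
    using G by (auto simp: RL_kernel_def indicator_def fun_eq_iff)
  finally show ?thesis using G by simp
qed

text \<open>The measure in \<open>RL_integral\<close> varies with \<open>t\<close>. The kernel form
  has a fixed measure and a jointly measurable integrand, so it is measurable as a parameter
  integral.\<close>

lemma measurable_RL_integral:
  assumes [measurable]: "f \<in> borel_measurable (lebesgue_on {a..b})" and "\<nu> \<ge> 0"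
  shows "RL_integral a \<nu> f \<in> borel_measurable (lebesgue_on {a..b})"
proof (cases "\<nu> = 0")
  case True
  then show ?thesis by (simp add: RL_integral_def[abs_def])
next
  case False
  interpret sigma_finite_measure "lebesgue_on {a..b}"
    by (rule sigma_finite_lebesgue_on_ivl)
  have "(\<lambda>t. LINT x|lebesgue_on {a..b}. RL_kernel \<nu> t x * f x) \<in> borel_measurable (lebesgue_on {a..b})"
    by measurable
  moreover have "RL_integral a \<nu> f t = (LINT x|lebesgue_on {a..b}. RL_kernel \<nu> t x * f x)"
    if "t \<in> space (lebesgue_on {a..b})" for t
    using that False assms by (intro RL_integral_eq) auto
  ultimately show ?thesis by (subst measurable_cong) auto
qed

text \<open>For positive order the majorant is the integral of the norm of kernel times
  \<open>f\<close>: finiteness means integrability, and the bound is the triangle inequality for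
  integrals.\<close>

lemma RL_integral_exists_and_bound:
  assumes [measurable]: "f \<in> borel_measurable (lebesgue_on {a..b})"
    and "\<nu> \<ge> 0" "t \<in> {a..b}" "RL_majorant a b \<nu> f t < \<infinity>"
  shows "RL_integral_exists a \<nu> f t"
    and "ennreal \<bar>RL_integral a \<nu> f t\<bar> \<le> RL_majorant a b \<nu> f t"
proof -
  have "RL_integral_exists a \<nu> f t \<and> ennreal \<bar>RL_integral a \<nu> f t\<bar> \<le> RL_majorant a b \<nu> f t"
  proof (cases "\<nu> = 0")
    case True
    then show ?thesis by (simp add: RL_integral_exists_def RL_integral_def RL_majorant_def)
  next
    case False
    with assms have \<nu>: "\<nu> > 0" by simp
    let ?M = "lebesgue_on {a..b}"
    have eq: "RL_majorant a b \<nu> f t = (\<integral>\<^sup>+x. ennreal (norm (RL_kernel \<nu> t x * f x)) \<partial>?M)"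
      using False RL_kernel_nonneg[OF \<nu>]
      by (simp add: RL_majorant_def abs_mult ennreal_mult)
    have int: "integrable ?M (\<lambda>x. RL_kernel \<nu> t x * f x)"
      using assms(4) unfolding eq by (intro integrableI_bounded) auto
    then show ?thesis
      using integral_norm_bound_ennreal[OF int] assms(3) \<nu>
      by (simp add: eq RL_integral_exists_iff[of \<nu> t a b f] RL_integral_eq[of \<nu> t a b f])
  qed
  then show "RL_integral_exists a \<nu> f t"
    and "ennreal \<bar>RL_integral a \<nu> f t\<bar> \<le> RL_majorant a b \<nu> f t" by auto
qed

section \<open>Convergence of the AB series almost everywhere\<close>

definition AB_majorant :: "(real \<Rightarrow> real) \<Rightarrow> real \<Rightarrow> real \<Rightarrow> real \<Rightarrow> real \<Rightarrow> (real \<Rightarrow> real) \<Rightarrow> real \<Rightarrow> ennreal" where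
  "AB_majorant B a b \<alpha> \<beta> f t =
     (\<Sum>k. ennreal \<bar>AB_coeff B \<alpha> \<beta> k\<bar> * RL_majorant a b (\<alpha> * real k) f t)"

text \<open>The coefficients in absolute value, weighted with the common bound for the
  \<open>L\<^sup>1\<close> and \<open>L\<^sup>\<infinity>\<close> operator norms; the final constant
  is this number plus 1.\<close>

definition AB_bound :: "(real \<Rightarrow> real) \<Rightarrow> real \<Rightarrow> real \<Rightarrow> real \<Rightarrow> real \<Rightarrow> real" where
  "AB_bound B a b \<alpha> \<beta> =
     (\<Sum>k. \<bar>AB_coeff B \<alpha> \<beta> k\<bar> * ((b - a) powr (\<alpha> * real k) / Gamma (\<alpha> * real k + 1)))"

lemma AB_weight_nonneg:
  fixes T :: real
  assumes "0 \<le> \<alpha>"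
  shows "0 \<le> T powr (\<alpha> * real k) / Gamma (\<alpha> * real k + 1)"
  using assms by (intro divide_nonneg_pos Gamma_real_pos) (auto simp: add_nonneg_pos)

text \<open>Carries the real series over to \<open>ennreal\<close>, where sums and integrals
  exchange freely. The factor \<open>c\<close> will be the integral of \<open>\<bar>f\<bar>\<close>
  in one estimate and an essential bound of \<open>f\<close> in the other.\<close>

lemma AB_bound_ennreal:
  assumes "0 \<le> \<alpha>" "\<alpha> \<le> 1" "a < b"
  shows "0 \<le> AB_bound B a b \<alpha> \<beta>"
    and "(\<Sum>k. ennreal \<bar>AB_coeff B \<alpha> \<beta> k\<bar> *
        (ennreal ((b - a) powr (\<alpha> * real k) / Gamma (\<alpha> * real k + 1)) * c))
      = ennreal (AB_bound B a b \<alpha> \<beta>) * c"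
proof -
  note nn = AB_weight_nonneg[OF assms(1)]
  have s: "summable (\<lambda>k. \<bar>AB_coeff B \<alpha> \<beta> k\<bar> * ((b - a) powr (\<alpha> * real k) / Gamma (\<alpha> * real k + 1)))"
    using assms by (intro summable_AB_coeff) auto
  show "0 \<le> AB_bound B a b \<alpha> \<beta>"
    unfolding AB_bound_def by (intro suminf_nonneg s mult_nonneg_nonneg nn) auto
  have "(\<Sum>k. ennreal \<bar>AB_coeff B \<alpha> \<beta> k\<bar> * (ennreal ((b - a) powr (\<alpha> * real k) / Gamma (\<alpha> * real k + 1)) * c))
    = (\<Sum>k. ennreal (\<bar>AB_coeff B \<alpha> \<beta> k\<bar> * ((b - a) powr (\<alpha> * real k) / Gamma (\<alpha> * real k + 1)))) * c"
    unfolding ennreal_suminf_multc[symmetric] by (simp only: ennreal_mult[OF abs_ge_zero nn] mult.assoc)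
  also have "(\<Sum>k. ennreal (\<bar>AB_coeff B \<alpha> \<beta> k\<bar> * ((b - a) powr (\<alpha> * real k) / Gamma (\<alpha> * real k + 1))))
      = ennreal (AB_bound B a b \<alpha> \<beta>)"
    unfolding AB_bound_def by (intro suminf_ennreal2 s mult_nonneg_nonneg nn) auto
  finally show "(\<Sum>k. ennreal \<bar>AB_coeff B \<alpha> \<beta> k\<bar> *
        (ennreal ((b - a) powr (\<alpha> * real k) / Gamma (\<alpha> * real k + 1)) * c))
      = ennreal (AB_bound B a b \<alpha> \<beta>) * c" .
qed

text \<open>Monotone convergence exchanges sum and integral, and each summand obeys the bound for a
  single Riemann-Liouville majorant.\<close>

lemma nn_integral_AB_majorant_le:
  assumes f: "f \<in> borel_measurable (lebesgue_on {a..b})" and "0 \<le> \<alpha>" "\<alpha> \<le> 1" "a < b"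
  shows "(\<integral>\<^sup>+t. AB_majorant B a b \<alpha> \<beta> f t \<partial>lebesgue_on {a..b})
    \<le> ennreal (AB_bound B a b \<alpha> \<beta>) * (\<integral>\<^sup>+x. ennreal \<bar>f x\<bar> \<partial>lebesgue_on {a..b})"
proof -
  note [measurable] = measurable_RL_majorant[OF f]
  have "(\<integral>\<^sup>+t. AB_majorant B a b \<alpha> \<beta> f t \<partial>lebesgue_on {a..b})
    = (\<Sum>k. ennreal \<bar>AB_coeff B \<alpha> \<beta> k\<bar> * (\<integral>\<^sup>+t. RL_majorant a b (\<alpha> * real k) f t \<partial>lebesgue_on {a..b}))"
    unfolding AB_majorant_def by (simp add: nn_integral_suminf nn_integral_cmult)
  also have "\<dots> \<le> (\<Sum>k. ennreal \<bar>AB_coeff B \<alpha> \<beta> k\<bar> *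
      (ennreal ((b - a) powr (\<alpha> * real k) / Gamma (\<alpha> * real k + 1)) * (\<integral>\<^sup>+x. ennreal \<bar>f x\<bar> \<partial>lebesgue_on {a..b})))"
    using assms by (intro suminf_le mult_left_mono nn_integral_RL_majorant_le) auto
  also have "\<dots> = ennreal (AB_bound B a b \<alpha> \<beta>) * (\<integral>\<^sup>+x. ennreal \<bar>f x\<bar> \<partial>lebesgue_on {a..b})"
    using assms by (intro AB_bound_ennreal)
  finally show ?thesis .
qed

text \<open>Absolute convergence by domination. Finiteness of each \<open>RL_majorant\<close> is a
  separate assumption: in \<open>ennreal\<close> a zero coefficient times \<infinity> is 0, so a
  finite \<open>AB_majorant\<close> may hide an integral that does not exist.\<close>

lemma iterated_AB_exists_and_bound:
  assumes "f \<in> borel_measurable (lebesgue_on {a..b})" "0 \<le> \<alpha>" "t \<in> {a..b}"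
    and RL: "\<And>k. RL_majorant a b (\<alpha> * real k) f t < \<infinity>"
    and AB: "AB_majorant B a b \<alpha> \<beta> f t < \<infinity>"
  shows "iterated_AB_exists B a \<alpha> \<beta> f t"
    and "ennreal \<bar>iterated_AB B a \<alpha> \<beta> f t\<bar> \<le> AB_majorant B a b \<alpha> \<beta> f t"
proof -
  have ex: "RL_integral_exists a (\<alpha> * real k) f t" 
    and le: "ennreal \<bar>RL_integral a (\<alpha> * real k) f t\<bar> \<le> RL_majorant a b (\<alpha> * real k) f t" for k
    using assms by (auto intro!: RL_integral_exists_and_bound)
  have "(\<Sum>k. ennreal \<bar>AB_term B a \<alpha> \<beta> f t k\<bar>) \<le> AB_majorant B a b \<alpha> \<beta> f t"
    unfolding AB_majorant_def AB_term_eq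
    by (intro suminf_le) (auto simp: abs_mult ennreal_mult intro!: mult_left_mono le)
  moreover from this have s: "summable (\<lambda>k. \<bar>AB_term B a \<alpha> \<beta> f t k\<bar>)"
    using AB by (intro summable_suminf_not_top) (auto simp: top_unique)
  ultimately have "ennreal (\<Sum>k. \<bar>AB_term B a \<alpha> \<beta> f t k\<bar>) \<le> AB_majorant B a b \<alpha> \<beta> f t"
    by (subst (asm) suminf_ennreal2) auto
  moreover have "\<bar>iterated_AB B a \<alpha> \<beta> f t\<bar> \<le> (\<Sum>k. \<bar>AB_term B a \<alpha> \<beta> f t k\<bar>)"
    unfolding iterated_AB_def using s by (rule summable_rabs)
  ultimately show "ennreal \<bar>iterated_AB B a \<alpha> \<beta> f t\<bar> \<le> AB_majorant B a b \<alpha> \<beta> f t"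
    using ennreal_leI order_trans by blast
  show "iterated_AB_exists B a \<alpha> \<beta> f t"
    unfolding iterated_AB_exists_def using ex s summable_rabs_cancel by blast
qed

text \<open>A function with finite integral is finite almost everywhere. This is applied to
  \<open>AB_majorant\<close> and to the countably many \<open>RL_majorant\<close>, whose exceptional
  null sets are united.\<close>

lemma AE_iterated_AB:
  assumes f: "integrable (lebesgue_on {a..b}) f" and "0 \<le> \<alpha>" "\<alpha> \<le> 1" "a < b"
  shows "AE t in lebesgue_on {a..b}. iterated_AB_exists B a \<alpha> \<beta> f t \<and>
    ennreal \<bar>iterated_AB B a \<alpha> \<beta> f t\<bar> \<le> AB_majorant B a b \<alpha> \<beta> f t"
proof -
  let ?M = "lebesgue_on {a..b}"
  have m: "f \<in> borel_measurable ?M" using f by simp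
  note [measurable] = measurable_RL_majorant[OF m]
  have fin: "(\<integral>\<^sup>+x. ennreal \<bar>f x\<bar> \<partial>?M) < \<infinity>"
    using f by (simp add: integrable_iff_bounded)
  have "AE t in ?M. RL_majorant a b (\<alpha> * real k) f t \<noteq> \<infinity>" for k
  proof (rule nn_integral_PInf_AE)
    have "(\<integral>\<^sup>+t. RL_majorant a b (\<alpha> * real k) f t \<partial>?M) < \<infinity>"
      using assms fin by (intro le_less_trans[OF nn_integral_RL_majorant_le[OF m]])
        (auto simp: ennreal_mult_less_top)
    then show "(\<integral>\<^sup>+t. RL_majorant a b (\<alpha> * real k) f t \<partial>?M) \<noteq> \<infinity>" by simp
  qed simp
  then have 1: "AE t in ?M. \<forall>k. RL_majorant a b (\<alpha> * real k) f t \<noteq> \<infinity>"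
    by (subst AE_all_countable) auto
  have 2: "AE t in ?M. AB_majorant B a b \<alpha> \<beta> f t \<noteq> \<infinity>"
  proof (rule nn_integral_PInf_AE)
    have "(\<integral>\<^sup>+t. AB_majorant B a b \<alpha> \<beta> f t \<partial>?M) < \<infinity>"
      using assms fin by (intro le_less_trans[OF nn_integral_AB_majorant_le[OF m]])
        (auto simp: ennreal_mult_less_top)
    then show "(\<integral>\<^sup>+t. AB_majorant B a b \<alpha> \<beta> f t \<partial>?M) \<noteq> \<infinity>" by simp
  qed (simp add: AB_majorant_def)
  from 1 2 AE_space show ?thesis
  proof eventually_elim
    case (elim t)
    then show ?case
      using iterated_AB_exists_and_bound[OF m assms(2), of t B \<beta>] by (auto simp: less_top)
  qed
qed

lemma measurable_iterated_AB:
  assumes f: "f \<in> borel_measurable (lebesgue_on {a..b})" and "0 \<le> \<alpha>"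
  shows "iterated_AB B a \<alpha> \<beta> f \<in> borel_measurable (lebesgue_on {a..b})"
proof -
  have [measurable]: "RL_integral a (\<alpha> * real k) f \<in> borel_measurable (lebesgue_on {a..b})" for k
    using assms by (intro measurable_RL_integral) auto
  show ?thesis
    unfolding iterated_AB_def[abs_def] AB_term_eq by measurable
qed

section \<open>The two norm estimates\<close>

lemma iterated_AB_L1:
  assumes f: "integrable (lebesgue_on {a..b}) f" and "0 \<le> \<alpha>" "\<alpha> \<le> 1" "a < b"
  shows "integrable (lebesgue_on {a..b}) (iterated_AB B a \<alpha> \<beta> f)"
    and "L1_norm a b (iterated_AB B a \<alpha> \<beta> f) \<le> AB_bound B a b \<alpha> \<beta> * L1_norm a b f"
proof -
  let ?M = "lebesgue_on {a..b}"
  have m: "f \<in> borel_measurable ?M" using f by simp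
  note K = AB_bound_ennreal(1)[OF assms(2-4), of B \<beta>]
  have L: "ennreal (L1_norm a b f) = (\<integral>\<^sup>+x. ennreal \<bar>f x\<bar> \<partial>?M)" "L1_norm a b f \<ge> 0"
    unfolding L1_norm_def using f by (auto simp: nn_integral_eq_integral)
  have "(\<integral>\<^sup>+t. ennreal \<bar>iterated_AB B a \<alpha> \<beta> f t\<bar> \<partial>?M) \<le> (\<integral>\<^sup>+t. AB_majorant B a b \<alpha> \<beta> f t \<partial>?M)"
    using AE_iterated_AB[OF assms, of B \<beta>] by (intro nn_integral_mono_AE) (auto elim!: eventually_mono)
  also have "\<dots> \<le> ennreal (AB_bound B a b \<alpha> \<beta>) * ennreal (L1_norm a b f)"
    unfolding L by (intro nn_integral_AB_majorant_le m assms)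
  also have "\<dots> = ennreal (AB_bound B a b \<alpha> \<beta> * L1_norm a b f)"
    using K L by (simp add: ennreal_mult)
  finally have le: "(\<integral>\<^sup>+t. ennreal \<bar>iterated_AB B a \<alpha> \<beta> f t\<bar> \<partial>?M) \<le> ennreal (AB_bound B a b \<alpha> \<beta> * L1_norm a b f)" .
  show int: "integrable ?M (iterated_AB B a \<alpha> \<beta> f)"
    using measurable_iterated_AB[OF m assms(2)] le
    by (intro integrableI_bounded) (auto intro: le_less_trans)
  \<comment> \<open>Integrability, just obtained from the finite bound \<open>le\<close>, identifies
    \<open>L1_norm\<close> with the \<open>ennreal\<close> integral and rules out the default value
    0.\<close>
  show "L1_norm a b (iterated_AB B a \<alpha> \<beta> f) \<le> AB_bound B a b \<alpha> \<beta> * L1_norm a b f"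
    using le int K L(2) unfolding L1_norm_def[of a b "iterated_AB B a \<alpha> \<beta> f"]
    by (subst (asm) nn_integral_eq_integral) (auto simp: ennreal_le_iff)
qed

lemma iterated_AB_Linf:
  assumes f: "integrable (lebesgue_on {a..b}) f" and "0 \<le> \<alpha>" "\<alpha> \<le> 1" "a < b"
    and K: "AB_bound B a b \<alpha> \<beta> \<le> K" "K > 0"
  shows "Linf_norm a b (iterated_AB B a \<alpha> \<beta> f) \<le> ereal K * Linf_norm a b f"
proof -
  let ?M = "lebesgue_on {a..b}"
  have m: "f \<in> borel_measurable ?M" using f by simp
  have AE: "AE x in ?M. ereal \<bar>f x\<bar> \<le> Linf_norm a b f"
    unfolding Linf_norm_def by (rule esssup_AE)
  \<comment> \<open>The interval has positive measure, so the essential supremum of the constant 0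
    is 0; comparison with it makes the norm of \<open>f\<close> nonnegative.\<close>
  have "emeasure ?M (space ?M) \<noteq> 0" using assms by (simp add: emeasure_restrict_space)
  then have "esssup ?M (\<lambda>x. 0 :: ereal) = 0" by (rule esssup_const)
  moreover have "esssup ?M (\<lambda>x. 0 :: ereal) \<le> Linf_norm a b f"
    unfolding Linf_norm_def by (intro esssup_mono) auto
  ultimately have nn: "0 \<le> Linf_norm a b f" by simp
  show ?thesis
  proof (cases "Linf_norm a b f")
    case PInf
    \<comment> \<open>\<open>K > 0\<close> makes the right-hand side \<infinity>, whereas
      \<infinity> times 0 would be 0.\<close>
    with K show ?thesis by simp
  next
    case MInf
    with nn show ?thesis by simp
  next
    case (real e)
    with nn have e: "e \<ge> 0" by simp
    from AE have fe: "AE x in ?M. \<bar>f x\<bar> \<le> e" by (simp add: real)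
    have "AE t in ?M. ereal \<bar>iterated_AB B a \<alpha> \<beta> f t\<bar> \<le> ereal (K * e)"
      using AE_iterated_AB[OF assms(1-4), of B \<beta>] fe AE_space
    proof eventually_elim
      case (elim t)
      \<comment> \<open>At almost every \<open>t\<close> the value \<open>\<bar>f t\<bar>\<close>
        itself is at most \<open>e\<close>, as the order 0 terms demand.\<close>
      have "AB_majorant B a b \<alpha> \<beta> f t \<le> (\<Sum>k. ennreal \<bar>AB_coeff B \<alpha> \<beta> k\<bar> *
        (ennreal ((b - a) powr (\<alpha> * real k) / Gamma (\<alpha> * real k + 1)) * ennreal e))"
        unfolding AB_majorant_def using elim fe assms
        by (intro suminf_le mult_left_mono RL_majorant_le_bound) auto
      also have "\<dots> = ennreal (AB_bound B a b \<alpha> \<beta>) * ennreal e"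
        using assms by (intro AB_bound_ennreal)
      also have "\<dots> \<le> ennreal K * ennreal e"
        using K by (intro mult_right_mono ennreal_leI) auto
      also have "\<dots> = ennreal (K * e)"
        using K e by (simp add: ennreal_mult)
      finally have "ennreal \<bar>iterated_AB B a \<alpha> \<beta> f t\<bar> \<le> ennreal (K * e)"
        using elim by (auto intro: order_trans)
      then show ?case using K e by (simp add: ennreal_le_iff)
    qed
    \<comment> \<open>Measurability matters here: \<open>esssup\<close> of a non-measurable function
      is \<infinity> by definition.\<close>
    then show ?thesis
      using measurable_iterated_AB[OF m assms(2), of B \<beta>] unfolding real
      by (subst Linf_norm_def) (auto intro!: esssup_I)
  qed
qed

theorem theorem3p3:
  fixes B :: "real \<Rightarrow> real" and a b \<alpha> \<beta> :: real
  assumes "\<And>x. x \<in> {0..1} \<Longrightarrow> B x > 0" and "B 0 = 1" and "B 1 = 1"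
    and "a < b" and "0 \<le> \<alpha>" and "\<alpha> \<le> 1"
  shows "\<exists>K::real. K > 0 \<and>
    (\<forall>f::real \<Rightarrow> real. integrable (lebesgue_on {a..b}) f \<longrightarrow>
       (AE t in lebesgue_on {a..b}. iterated_AB_exists B a \<alpha> \<beta> f t) \<and>
       integrable (lebesgue_on {a..b}) (iterated_AB B a \<alpha> \<beta> f) \<and>
       L1_norm a b (iterated_AB B a \<alpha> \<beta> f) \<le> K * L1_norm a b f \<and>
       (continuous_on {a..b} f \<longrightarrow>
          Linf_norm a b (iterated_AB B a \<alpha> \<beta> f) \<le> ereal K * Linf_norm a b f))"
\<comment> \<open>\<open>AB_bound\<close> does not depend on \<open>f\<close>. Adding 1 makes the
  constant strictly positive, since all coefficients vanish when \<alpha> is 1 and \<beta> is not a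
  natural number.\<close>
proof (intro exI[of _ "AB_bound B a b \<alpha> \<beta> + 1"] conjI allI impI)
  show K: "AB_bound B a b \<alpha> \<beta> + 1 > 0"
    using AB_bound_ennreal(1)[OF assms(5,6,4), of B \<beta>] by simp
  fix f :: "real \<Rightarrow> real" assume f: "integrable (lebesgue_on {a..b}) f"
  note H = f assms(5,6,4)
  show "AE t in lebesgue_on {a..b}. iterated_AB_exists B a \<alpha> \<beta> f t"
    using AE_iterated_AB[OF H, of B \<beta>] by (auto elim!: eventually_mono)
  show "integrable (lebesgue_on {a..b}) (iterated_AB B a \<alpha> \<beta> f)"
    by (rule iterated_AB_L1[OF H])
  have "L1_norm a b f \<ge> 0" by (simp add: L1_norm_def)
  with iterated_AB_L1(2)[OF H, of B \<beta>]
  show "L1_norm a b (iterated_AB B a \<alpha> \<beta> f) \<le> (AB_bound B a b \<alpha> \<beta> + 1) * L1_norm a b f"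
    by (simp add: algebra_simps)
  show "Linf_norm a b (iterated_AB B a \<alpha> \<beta> f) \<le> ereal (AB_bound B a b \<alpha> \<beta> + 1) * Linf_norm a b f"
    using K by (intro iterated_AB_Linf[OF H]) auto
qed

end
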